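(* Let $K \subsetneq L$ be a field extension, and let $A$ and $B$ be two $n$-dimensional $K$-subspaces of $L$, with $0 < n < \infty$ and $1 \notin B$. Let $0 \leq d \leq n$ be an integer. Then $A$ is partially matched to $B$ with defect $d$ if and only if, for every pair of nonzero $K$-subspaces $S\subseteq A$ and $R\subseteq B \oplus K$ with $SR = S$, we have $$\dim S-d\leq \dim \big(B/(B\cap R)\big).$$
   Context: Fields are commutative. All dimensions are over $K$ unless indicated otherwise. $[n]=\{1,\dots,n\}$, and $\langle X\rangle$ denotes the $K$-span of a set $X$. For $K$-subspaces $S,R$ of $L$, $SR=\{sr : s\in S,\ r\in R\}$ is the Minkowski product (a set, not its span). All direct sums are internal; since $1\notin B$, the sum $B+K$ in $L$ is direct and is written $B\oplus K$. Definition (partial matching of bases). Let $A,B$ be $n$-dimensional $K$-subspaces of $L$, $n\ge 1$, and $0\le d\le n$ an integer. An ordered basis $\mathcal{A}=\{a_1,\dots,a_n\}$ of $A$ is partially matched to an ordered basis $\mathcal{B}=\{b_1,\dots,b_n\}$ of $B$ with defect $d$ if there exists $P\subseteq[n]$ with $|P|=n-d$ such that $$a_i^{-1}A\cap B\subseteq \langle b_1,\dots,b_{i-1},b_{i+1},\dots,b_n\rangle\quad\text{for each } i\in P.$$ Definition (partial matching of subspaces). $A$ is partially matched to $B$ with defect $d$ if for every ordered basis $\mathcal{A}$ of $A$ there exists an ordered basis $\mathcal{B}$ of $B$ such that $\mathcal{A}$ is partially matched to $\mathcal{B}$ with defect $d$. *)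

theory Defs
  imports HOL.Vector_Spaces "HOL-Library.Set_Algebras"
begin

context vector_space
begin

text \<open>
  The quotient of a subspace \<open>B\<close> by a subspace \<open>W \<subseteq> B\<close> is the set of cosets \<open>x +o W\<close> with
  \<open>x \<in> B\<close>; sums of cosets are sums of sets. In \<open>quot_lincomb\<close> the summand \<open>W\<close> is the zero of the
  quotient. It only matters when all coefficients vanish: the elementwise multiple of a coset by
  \<open>0\<close> is \<open>{0}\<close>, not \<open>W\<close>.
\<close>

definition quot :: "'b set \<Rightarrow> 'b set \<Rightarrow> 'b set set"
  where "quot B W = {x +o W | x. x \<in> B}"

definition quot_lincomb :: "'b set \<Rightarrow> 'b set set \<Rightarrow> ('b set \<Rightarrow> 'a) \<Rightarrow> 'b set"
  where "quot_lincomb W C f = (\<Sum>X\<in>C. scale (f X) ` X) + W"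

definition quot_basis :: "'b set \<Rightarrow> 'b set \<Rightarrow> 'b set set \<Rightarrow> bool"
  where "quot_basis B W C \<longleftrightarrow> finite C \<and> C \<subseteq> quot B W \<and>
    (\<forall>f. quot_lincomb W C f = W \<longrightarrow> (\<forall>X\<in>C. f X = 0)) \<and>
    (\<forall>Y\<in>quot B W. \<exists>f. Y = quot_lincomb W C f)"

text \<open>As for \<^const>\<open>dim\<close>, an infinite-dimensional quotient gets the value \<open>0\<close>.\<close>

definition quot_dim :: "'b set \<Rightarrow> 'b set \<Rightarrow> nat"
  where "quot_dim B W = (if \<exists>C. quot_basis B W C then card (SOME C. quot_basis B W C) else 0)"

end

text \<open>
  A field extension is a homomorphism of fields \<open>emb\<close> (automatically injective); \<open>K\<close> is
  identified with \<open>range emb\<close>.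
\<close>

locale field_extension =
  fixes emb :: "'k::field \<Rightarrow> 'l::field"
  assumes emb_add: "emb (x + y) = emb x + emb y"
    and emb_mult: "emb (x * y) = emb x * emb y"
    and emb_one: "emb 1 = 1"

definition ext_scale :: "('k::field \<Rightarrow> 'l::field) \<Rightarrow> 'k \<Rightarrow> 'l \<Rightarrow> 'l"
  where "ext_scale emb c x = emb c * x"

lemma (in field_extension) vector_space_ext_scale: "vector_space (ext_scale emb)"
  by standard (simp_all add: ext_scale_def emb_add emb_mult emb_one algebra_simps)

abbreviation ext_subspace :: "('k::field \<Rightarrow> 'l::field) \<Rightarrow> 'l set \<Rightarrow> bool"
  where "ext_subspace emb \<equiv> module.subspace (ext_scale emb)"

abbreviation ext_span :: "('k::field \<Rightarrow> 'l::field) \<Rightarrow> 'l set \<Rightarrow> 'l set"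
  where "ext_span emb \<equiv> module.span (ext_scale emb)"

abbreviation ext_independent :: "('k::field \<Rightarrow> 'l::field) \<Rightarrow> 'l set \<Rightarrow> bool"
  where "ext_independent emb X \<equiv> \<not> module.dependent (ext_scale emb) X"

abbreviation ext_dim :: "('k::field \<Rightarrow> 'l::field) \<Rightarrow> 'l set \<Rightarrow> nat"
  where "ext_dim emb \<equiv> vector_space.dim (ext_scale emb)"

abbreviation ext_quot_dim :: "('k::field \<Rightarrow> 'l::field) \<Rightarrow> 'l set \<Rightarrow> 'l set \<Rightarrow> nat"
  where "ext_quot_dim emb \<equiv> vector_space.quot_dim (ext_scale emb)"

text \<open>Ordered bases are families indexed by \<open>{1..n}\<close>; values elsewhere play no role.\<close>

definition ordered_basis ::
    "('k::field \<Rightarrow> 'l::field) \<Rightarrow> nat \<Rightarrow> (nat \<Rightarrow> 'l) \<Rightarrow> 'l set \<Rightarrow> bool"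
  where "ordered_basis emb n a A \<longleftrightarrow>
    inj_on a {1..n} \<and> ext_independent emb (a ` {1..n}) \<and> ext_span emb (a ` {1..n}) = A"

text \<open>The two notions below are meant for \<open>d \<le> n\<close>.\<close>

definition bases_partially_matched ::
    "('k::field \<Rightarrow> 'l::field) \<Rightarrow> nat \<Rightarrow> 'l set \<Rightarrow> 'l set \<Rightarrow> nat \<Rightarrow> (nat \<Rightarrow> 'l) \<Rightarrow> (nat \<Rightarrow> 'l) \<Rightarrow> bool"
  where "bases_partially_matched emb n A B d a b \<longleftrightarrow>
    (\<exists>P \<subseteq> {1..n}. card P = n - d \<and>
      (\<forall>i\<in>P. (inverse (a i) *o A) \<inter> B \<subseteq> ext_span emb (b ` ({1..n} - {i}))))"

definition partially_matched ::
    "('k::field \<Rightarrow> 'l::field) \<Rightarrow> nat \<Rightarrow> 'l set \<Rightarrow> 'l set \<Rightarrow> nat \<Rightarrow> bool"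
  where "partially_matched emb n A B d \<longleftrightarrow>
    (\<forall>a. ordered_basis emb n a A \<longrightarrow>
      (\<exists>b. ordered_basis emb n b B \<and> bases_partially_matched emb n A B d a b))"

end

theory Submission
  imports Defs
begin

text \<open>
  Fix an ordered basis \<open>a\<close> of \<open>A\<close> and put \<open>V i = a i\<^sup>-\<^sup>1 A \<inter> B\<close>. By a linear form of Rado's theorem with
  defect, a matching basis of \<open>B\<close> exists iff \<open>dim (\<Inter>i\<in>J. V i) + card J \<le> n + d\<close> for all \<open>J\<close>. As the
  bases of \<open>A\<close> vary, the span \<open>S\<close> of the \<open>a i\<close> with \<open>i \<in> J\<close> runs over all subspaces of \<open>A\<close>, so the
  requirement becomes \<open>dim S + dim {x \<in> B. S x \<subseteq> A} \<le> n + d\<close>. If it fails for \<open>S\<close>, start from \<open>S\<close> and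
  \<open>U = {x \<in> B. S x \<subseteq> A} + K\<close>. For \<open>e \<in> S\<close> the Dyson transform, which replaces \<open>S\<close> by \<open>S + e U\<close> and \<open>U\<close> by
  \<open>U \<inter> e\<^sup>-\<^sup>1 S\<close>, preserves \<open>dim S + dim U\<close>, \<open>S U \<subseteq> A\<close> and \<open>1 \<in> U\<close>. It strictly shrinks \<open>U\<close> unless
  \<open>e U \<subseteq> S\<close>, so iterating it ends in a pair with \<open>S U = S\<close>, which violates the criterion.
\<close>

section \<open>Finite-dimensional subspaces: bases, independence of unions, the modular law for
  dimensions\<close>

context vector_space
begin

text \<open>Since \<open>dim\<close> is 0 for infinite-dimensional sets, finiteness has to be
  recorded separately. Only an inclusion in a finite span is required, so the property makes sense
  for any set and passes to subsets.\<close>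

definition fin_dim :: "'b set \<Rightarrow> bool"
  where "fin_dim V \<longleftrightarrow> (\<exists>F. finite F \<and> V \<subseteq> span F)"

lemma fin_dim_subset: "fin_dim W \<Longrightarrow> V \<subseteq> W \<Longrightarrow> fin_dim V"
  unfolding fin_dim_def by blast

text \<open>An infinite basis would have cardinality 0. This is how the assumptions that
  \<open>A\<close> and \<open>B\<close> have dimension \<open>n > 0\<close> yield
  finite-dimensionality.\<close>

lemma fin_dim_if_dim_pos:
  assumes "dim V > 0"
  shows "fin_dim V"
proof -
  obtain E where E: "E \<subseteq> V" "independent E" "V \<subseteq> span E" "card E = dim V"
    using basis_exists by blast
  then have "finite E"
    using assms card.infinite by fastforce
  with E show ?thesis unfolding fin_dim_def by blast
qed

lemma fin_dim_extend_basis: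
  assumes "subspace V" "fin_dim V" "independent E" "E \<subseteq> V"
  obtains D where "E \<subseteq> D" "finite D" "independent D" "span D = V" "card D = dim V"
proof -
  obtain D where D: "E \<subseteq> D" "D \<subseteq> V" "independent D" "V \<subseteq> span D"
    using maximal_independent_subset_extend[OF assms(4,3)] by blast
  obtain F where "finite F" "V \<subseteq> span F"
    using assms(2) unfolding fin_dim_def by blast
  then have "finite D"
    using independent_span_bound[of F D] D by blast
  moreover have "span D = V"
    using D assms(1) by (simp add: span_subspace)
  ultimately show ?thesis
    using that D dim_span_eq_card_independent by metis
qed

lemma fin_dim_basis:
  assumes "subspace V" "fin_dim V"
  obtains D where "finite D" "independent D" "span D = V" "card D = dim V"
  using fin_dim_extend_basis[OF assms independent_empty] by blast

lemma fin_dim_mono: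
  assumes "fin_dim W" "subspace W" "V \<subseteq> W"
  shows "dim V \<le> dim W"
proof -
  obtain D where "finite D" "span D = W" "card D = dim W"
    using fin_dim_basis assms by metis
  then show ?thesis
    using dim_le_card[of V D] assms by simp
qed

lemma fin_dim_psubset:
  assumes "fin_dim W" "subspace W" "subspace V" "V \<subset> W"
  shows "dim V < dim W"
proof -
  obtain E where E: "finite E" "independent E" "span E = V" "card E = dim V"
    using fin_dim_basis fin_dim_subset assms by (metis psubset_imp_subset)
  obtain D where D: "E \<subseteq> D" "finite D" "independent D" "span D = W" "card D = dim W"
    using fin_dim_extend_basis[OF assms(2,1) E(2)] E(3) assms(4) span_superset by blast
  have "E \<noteq> D" using E D assms(4) by blast
  then show ?thesis
    using psubset_card_mono[of D E] D E by auto
qed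

text \<open>Coordinates with respect to \<open>X\<close> are unique, so the basis vectors occurring
  in \<open>v\<close> with nonzero coefficient lie in every \<open>Y\<close> whose span contains
  \<open>v\<close>. It later turns several conditions "the coordinate at \<open>b i\<close>
  vanishes" into membership in a single span.\<close>

lemma span_Inter_independent:
  assumes "independent X" "F \<noteq> {}" "\<And>Y. Y \<in> F \<Longrightarrow> Y \<subseteq> X" "\<And>Y. Y \<in> F \<Longrightarrow> v \<in> span Y"
  shows "v \<in> span (\<Inter>F)"
proof -
  have vX: "v \<in> span X"
    using assms(2-4) span_mono by blast
  have "b \<in> \<Inter>F" if "representation X v b \<noteq> 0" for b
  proof
    fix Y assume "Y \<in> F"
    then have "representation X v = representation Y v"
      using assms by (intro representation_extend) auto
    then show "b \<in> Y"
      using that representation_ne_zero by metis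
  qed
  moreover have "(\<Sum>b | representation X v b \<noteq> 0. scale (representation X v b) b) = v"
    by (rule sum_nonzero_representation_eq[OF assms(1) vX])
  ultimately show ?thesis
    by (metis (mono_tags, lifting) mem_Collect_eq span_base span_scale span_sum)
qed

lemma span_disjoint_independent:
  assumes "independent X" "Y \<subseteq> X" "Z \<subseteq> X" "Y \<inter> Z = {}" "v \<in> span Y" "v \<in> span Z"
  shows "v = 0"
  using span_Inter_independent[of X "{Y, Z}" v] assms by auto

lemma independent_Un_span:
  assumes "finite C" "independent C" "independent D" "span C \<inter> span D \<subseteq> {0}"
  shows "independent (C \<union> D)" "C \<inter> D = {}"
proof -
  show "C \<inter> D = {}"
    using assms dependent_zero span_base by blast
  have "independent (Q \<union> D)" if "Q \<subseteq> C" for Q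
    using finite_subset[OF that assms(1)] that
  proof (induction Q rule: finite_induct)
    case empty
    then show ?case using assms by simp
  next
    case (insert x Q)
    have "x \<notin> span (Q \<union> D)"
    proof
      assume "x \<in> span (Q \<union> D)"
      then obtain q e where qe: "x = q + e" "q \<in> span Q" "e \<in> span D"
        unfolding span_Un by blast
      have "q \<in> span C" "x \<in> span C"
        using qe insert.prems span_mono[of Q C] span_base by blast+
      then have "e \<in> span C"
        using qe span_diff[of x C q] by simp
      then have "x \<in> span Q"
        using qe assms(4) by auto
      moreover have "independent (insert x Q)"
        using independent_mono[OF assms(2)] insert.prems by blast
      ultimately show False
        using insert.hyps independent_insert by auto
    qed
    then show ?case
      using insert by (simp add: independent_insertI)
  qed
  then show "independent (C \<union> D)" by blast
qed

lemma subspace_set_plus: "subspace S \<Longrightarrow> subspace T \<Longrightarrow> subspace (S + T)"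
  using subspace_sums[of S T] unfolding set_plus_def
  by (rule back_subst[of subspace]) auto

lemma span_Un_set_plus: "span (S \<union> T) = span S + span T"
  unfolding span_Un set_plus_def by blast

lemma dim_set_plus_Int:
  assumes "subspace S" "subspace T" "fin_dim S" "fin_dim T"
  shows "dim (S + T) + dim (S \<inter> T) = dim S + dim T"
proof -
  obtain C where C: "finite C" "independent C" "span C = S" "card C = dim S"
    using fin_dim_basis assms by metis
  obtain E where E: "finite E" "independent E" "span E = S \<inter> T" "card E = dim (S \<inter> T)"
    using fin_dim_basis[of "S \<inter> T"] fin_dim_subset assms subspace_inter by (metis inf_le1)
  have "E \<subseteq> T" using E(3) span_superset[of E] by blast
  then obtain D where D: "E \<subseteq> D" "finite D" "independent D" "span D = T" "card D = dim T"
    using fin_dim_extend_basis[OF assms(2,4) E(2)] by blast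
  have ind: "independent (D - E)"
    using independent_mono[OF D(3)] by blast
  \<comment> \<open>\<open>E\<close> is a basis of the intersection of \<open>S\<close> and
    \<open>T\<close>. A vector of \<open>S\<close> in the span of \<open>D - E\<close> lies in that
    intersection, hence also in the span of \<open>E\<close>, and must vanish. So \<open>C\<close>
    and \<open>D - E\<close> together form a basis of \<open>S + T\<close>.\<close>
  have "span C \<inter> span (D - E) \<subseteq> {0}"
  proof
    fix x assume x: "x \<in> span C \<inter> span (D - E)"
    then have "x \<in> span E"
      using C E D span_mono[of "D - E" D] by blast
    then show "x \<in> {0}"
      using span_disjoint_independent[OF D(3), of "D - E" E x] x D(1) by blast
  qed
  note CD = independent_Un_span[OF C(1,2) ind this]
  have "span D = span E + span (D - E)"
    using D(1) span_Un_set_plus[of E "D - E"] by (simp add: Un_absorb1)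
  moreover have "S + span E = S"
    using E(3) subspace_add[OF assms(1)] set_zero_plus2[of "span E" S] span_zero[of E]
    by (auto simp: set_plus_def[of S] add.commute)
  ultimately have "span (C \<union> (D - E)) = S + T"
    using C(3) D(4) by (metis add.assoc span_Un_set_plus)
  then have "dim (S + T) = card (C \<union> (D - E))"
    using CD dim_span_eq_card_independent by metis
  also have "\<dots> = card C + (card D - card E)"
    using CD C D E by (simp add: card_Un_disjoint card_Diff_subset)
  finally show ?thesis
    using C D E card_mono[of D E] by simp
qed

lemma dim_span_insert:
  assumes "subspace W" "fin_dim W" "x \<notin> W"
  shows "dim (span (insert x W)) = dim W + 1"
proof -
  obtain E where E: "finite E" "independent E" "span E = W" "card E = dim W"
    using fin_dim_basis assms by metis
  have "span (insert x W) = span (insert x E)"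
    using E(3) eq_span_insert_eq
    by (metis insert_is_Un span_Un_set_plus span_span)
  moreover have "independent (insert x E)"
    using E assms independent_insertI by blast
  moreover have "x \<notin> E"
    using E assms span_base by blast
  ultimately show ?thesis
    using E dim_span_eq_card_independent by (metis Suc_eq_plus1 card_insert_disjoint)
qed

section \<open>Cosets and the dimension of a quotient\<close>

lemma coset_eq_iff:
  assumes "subspace W"
  shows "x +o W = y +o W \<longleftrightarrow> x - y \<in> W"
proof
  assume "x +o W = y +o W"
  then have "x \<in> y +o W"
    using subspace_0[OF assms] by (metis add.right_neutral set_plus_intro2)
  then show "x - y \<in> W" by (rule set_plus_imp_minus)
next
  assume xy: "x - y \<in> W"
  have "z \<in> x +o W \<longleftrightarrow> z \<in> y +o W" for z
    using subspace_add[OF assms xy, of "z - x"] subspace_diff[OF assms _ xy, of "z - y"]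
    unfolding set_minus_plus[symmetric] by auto
  then show "x +o W = y +o W" by blast
qed

text \<open>Choosing representatives reduces set-valued combinations to ordinary ones. The trailing
  summand \<open>W\<close> absorbs the multiples of \<open>W\<close> contributed by each coset, and
  supplies \<open>W\<close> itself when a coefficient 0 collapses a coset to
  \<open>{0}\<close>.\<close>

lemma quot_lincomb_rep:
  assumes "subspace W" "finite C" "\<And>X. X \<in> C \<Longrightarrow> X = r X +o W"
  shows "quot_lincomb W C f = (\<Sum>X\<in>C. scale (f X) (r X)) +o W"
  using assms(2,3) unfolding quot_lincomb_def
proof (induction C rule: finite_induct)
  case empty
  then show ?case by simp
next
  case (insert X C)
  let ?s = "\<Sum>X\<in>C. scale (f X) (r X)"
  have "scale (f X) ` X + (?s +o W) = (scale (f X) (r X) + ?s) +o W" (is "?l = ?r")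
  proof
    show "?l \<subseteq> ?r"
    proof
      fix z assume "z \<in> ?l"
      then obtain x w where z: "x \<in> X" "w \<in> W" "z = scale (f X) x + (?s + w)"
        unfolding set_plus_def elt_set_plus_def by blast
      then obtain w' where "w' \<in> W" "x = r X + w'"
        using insert.prems[of X] unfolding elt_set_plus_def by blast
      then have "z = scale (f X) (r X) + ?s + (scale (f X) w' + w)"
        using z by (simp add: scale_right_distrib algebra_simps)
      moreover have "scale (f X) w' + w \<in> W"
        using \<open>w' \<in> W\<close> z assms(1) subspace_add subspace_scale by blast
      ultimately show "z \<in> ?r" by blast
    qed
  next
    have "r X \<in> X"
      using insert.prems[of X] subspace_0[OF assms(1)]
      by (metis add.right_neutral insertI1 set_plus_intro2)
    then show "?r \<subseteq> ?l"
      unfolding set_plus_def elt_set_plus_def by (force simp: add.assoc)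
  qed
  then show ?case
    using insert by (simp add: add.assoc)
qed

text \<open>Representatives of a basis of the quotient, joined with a basis of \<open>W\<close>,
  form a basis of \<open>B\<close>. Hence all bases of the quotient have the same size, and the
  arbitrary choice in \<open>quot_dim\<close> is harmless.\<close>

lemma quot_basis_card:
  assumes "subspace B" "subspace W" "W \<subseteq> B" "fin_dim B" "quot_basis B W C"
  shows "card C + dim W = dim B"
proof -
  have C: "finite C" "C \<subseteq> quot B W" "\<And>f X. quot_lincomb W C f = W \<Longrightarrow> X \<in> C \<Longrightarrow> f X = 0"
    "\<And>Y. Y \<in> quot B W \<Longrightarrow> \<exists>f. Y = quot_lincomb W C f"
    using assms(5) unfolding quot_basis_def by blast+
  have "\<forall>X\<in>C. \<exists>x\<in>B. X = x +o W"
    using C(2) unfolding quot_def by blast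
  then obtain r where r: "\<And>X. X \<in> C \<Longrightarrow> r X \<in> B" "\<And>X. X \<in> C \<Longrightarrow> X = r X +o W"
    by metis
  have lc: "quot_lincomb W C f = (\<Sum>X\<in>C. scale (f X) (r X)) +o W" for f
    using quot_lincomb_rep[OF assms(2) C(1)] r(2) by blast
  have lin: "f X = 0" if "(\<Sum>X\<in>C. scale (f X) (r X)) \<in> W" "X \<in> C" for f X
  proof -
    have "quot_lincomb W C f = 0 +o W"
      unfolding lc coset_eq_iff[OF assms(2)] using that by simp
    then show ?thesis using C(3) that by simp
  qed
  have inj: "inj_on r C"
    using r(2) by (metis inj_onI)
  have reindex: "(\<Sum>v\<in>r ` C. scale (g v) v) = (\<Sum>X\<in>C. scale (g (r X)) (r X))" for g
    using inj by (simp add: sum.reindex)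
  have ind: "independent (r ` C)"
  proof (rule independent_if_scalars_zero)
    fix g v assume "(\<Sum>v\<in>r ` C. scale (g v) v) = 0" "v \<in> r ` C"
    then show "g v = 0"
      using lin[of "g \<circ> r"] subspace_0[OF assms(2)] by (auto simp: reindex)
  qed (use C in simp)
  obtain E where E: "finite E" "independent E" "span E = W" "card E = dim W"
    using fin_dim_basis fin_dim_subset assms by metis
  have "span (r ` C) \<inter> span E \<subseteq> {0}"
  proof
    fix v assume v: "v \<in> span (r ` C) \<inter> span E"
    then obtain g where g: "v = (\<Sum>v\<in>r ` C. scale (g v) v)"
      using span_finite[of "r ` C"] C(1) by auto
    then have "\<And>X. X \<in> C \<Longrightarrow> g (r X) = 0"
      using lin[of "g \<circ> r"] v E(3) by (simp add: reindex)
    then show "v \<in> {0}"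
      using g by (simp add: reindex)
  qed
  note un = independent_Un_span[OF finite_imageI[OF C(1)] ind E(2) this]
  have "span (r ` C \<union> E) = B"
  proof
    show "span (r ` C \<union> E) \<subseteq> B"
      using r(1) E(3) assms(1,3) span_superset[of E] by (intro span_minimal) blast+
    show "B \<subseteq> span (r ` C \<union> E)"
    proof
      fix y assume "y \<in> B"
      then obtain f where "y +o W = quot_lincomb W C f"
        using C(4)[of "y +o W"] unfolding quot_def by blast
      then have "y - (\<Sum>X\<in>C. scale (f X) (r X)) \<in> span E"
        unfolding lc coset_eq_iff[OF assms(2)] using E by simp
      moreover have "(\<Sum>X\<in>C. scale (f X) (r X)) \<in> span (r ` C)"
        by (intro span_sum span_scale span_base) simp
      ultimately show "y \<in> span (r ` C \<union> E)"
        unfolding span_Un_set_plus by (metis diff_add_cancel add.commute set_plus_intro)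
    qed
  qed
  then have "dim B = card (r ` C \<union> E)"
    using un dim_span_eq_card_independent by metis
  then show ?thesis
    using un C E inj by (simp add: card_Un_disjoint card_image)
qed

text \<open>Extend a basis \<open>E\<close> of \<open>W\<close> to a basis \<open>D\<close> of
  \<open>B\<close>; the cosets of the vectors in \<open>D - E\<close> form a basis of the
  quotient.\<close>

lemma quot_basis_exists:
  assumes "subspace B" "subspace W" "W \<subseteq> B" "fin_dim B"
  shows "\<exists>C. quot_basis B W C"
proof -
  obtain E where E: "finite E" "independent E" "span E = W"
    using fin_dim_basis fin_dim_subset assms by metis
  then have "E \<subseteq> B" using assms(3) span_superset by blast
  then obtain D where D: "E \<subseteq> D" "finite D" "independent D" "span D = B"
    using fin_dim_extend_basis[OF assms(1,4) E(2)] by blast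
  let ?q = "\<lambda>x. x +o W"
  have q: "inj_on ?q (D - E)"
  proof (rule inj_onI, rule ccontr)
    fix x y assume xy: "x \<in> D - E" "y \<in> D - E" "x +o W = y +o W" "x \<noteq> y"
    then have "x - y \<in> span E" using coset_eq_iff assms(2) E by blast
    moreover have "E \<subseteq> D - {x}" using D(1) xy(1) by blast
    ultimately have "x - y \<in> span (D - {x})" using span_mono by blast
    moreover have "y \<in> span (D - {x})" using xy by (intro span_base) simp
    ultimately have "x \<in> span (D - {x})" by (metis diff_add_cancel span_add)
    then show False using D(3) xy unfolding dependent_def by blast
  qed
  define C where "C = ?q ` (D - E)"
  define r where "r = inv_into (D - E) ?q"
  have r: "X = r X +o W" if "X \<in> C" for X
    using that f_inv_into_f[of X ?q "D - E"] unfolding C_def r_def by simp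
  have finC: "finite C" unfolding C_def using D by simp
  have lc: "quot_lincomb W C f = (\<Sum>x\<in>D - E. scale (f (x +o W)) x) +o W" for f
  proof -
    have "quot_lincomb W C f = (\<Sum>X\<in>C. scale (f X) (r X)) +o W"
      using quot_lincomb_rep[OF assms(2) finC] r by blast
    also have "(\<Sum>X\<in>C. scale (f X) (r X)) = (\<Sum>x\<in>D - E. scale (f (x +o W)) x)"
      unfolding C_def sum.reindex[OF q] r_def by (simp add: inv_into_f_f[OF q])
    finally show ?thesis .
  qed
  have "quot_basis B W C"
    unfolding quot_basis_def
  proof (intro conjI allI ballI impI finC)
    show "C \<subseteq> quot B W"
      unfolding C_def quot_def using D(4) span_superset[of D] by blast
  next
    fix f X assume f: "quot_lincomb W C f = W" and X: "X \<in> C"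
    let ?s = "\<Sum>x\<in>D - E. scale (f (x +o W)) x"
    have "?s +o W = 0 +o W" using f lc by simp
    then have "?s \<in> span E" unfolding coset_eq_iff[OF assms(2)] using E by simp
    moreover have "?s \<in> span (D - E)" by (intro span_sum span_scale span_base)
    ultimately have "?s = 0"
      using span_disjoint_independent[OF D(3), of "D - E" E] D(1) by blast
    then have "f (x +o W) = 0" if "x \<in> D - E" for x
      using independentD[OF D(3), of "D - E" "\<lambda>x. f (x +o W)"] D(2) that by blast
    then show "f X = 0" using X unfolding C_def by blast
  next
    fix Y assume "Y \<in> quot B W"
    then obtain y where y: "y \<in> B" "Y = y +o W" unfolding quot_def by blast
    then obtain g where g: "y = (\<Sum>v\<in>D. scale (g v) v)"
      using span_finite[OF D(2)] D(4) by auto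
    have "y - (\<Sum>v\<in>D - E. scale (g v) v) = (\<Sum>v\<in>E. scale (g v) v)"
      unfolding g using sum.subset_diff[OF D(1,2), of "\<lambda>v. scale (g v) v"] by simp
    also have "\<dots> \<in> span E" by (intro span_sum span_scale span_base)
    finally have "Y = (\<Sum>x\<in>D - E. scale (g x) x) +o W"
      using y coset_eq_iff[OF assms(2)] E by simp
    \<comment> \<open>The coefficients in \<open>quot_lincomb\<close> are indexed by cosets, so
      \<open>g\<close> is transported along the injection sending \<open>x\<close> to
      \<open>x +o W\<close>.\<close>
    also have "(\<Sum>x\<in>D - E. scale (g x) x) = (\<Sum>x\<in>D - E. scale (g (inv_into (D - E) ?q (x +o W))) x)"
      by (simp add: inv_into_f_f[OF q])
    finally show "\<exists>f. Y = quot_lincomb W C f"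
      unfolding lc by (intro exI[of _ "g \<circ> inv_into (D - E) ?q"]) simp
  qed
  then show ?thesis ..
qed

lemma quot_dim_plus_dim:
  assumes "subspace B" "subspace W" "W \<subseteq> B" "fin_dim B"
  shows "quot_dim B W + dim W = dim B"
  using quot_basis_card[OF assms] quot_basis_exists[OF assms] someI_ex[of "quot_basis B W"]
  unfolding quot_dim_def by auto


section \<open>A linear form of Rado's theorem with defect\<close>

text \<open>
  The last condition on \<open>H i\<close> says that its codimension in \<open>B\<close> is at most one. A space \<open>V i\<close> of larger
  codimension is the intersection of two strictly larger ones; if neither could replace it, modularity
  of the dimension would contradict the hypothesis for \<open>J \<inter> J'\<close> and \<open>J \<union> J' \<union> {i}\<close>.
\<close>

lemma enlarge_to_hyperplanes:
  assumes B: "subspace B" "fin_dim B" and I: "finite I"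
    and V: "\<And>i. i \<in> I \<Longrightarrow> subspace (V i)" "\<And>i. i \<in> I \<Longrightarrow> V i \<subseteq> B"
    and dims: "\<And>J. J \<subseteq> I \<Longrightarrow> dim (B \<inter> (\<Inter>i\<in>J. V i)) + card J \<le> dim B + d"
  shows "\<exists>H. (\<forall>i\<in>I. subspace (H i) \<and> V i \<subseteq> H i \<and> H i \<subseteq> B \<and>
      (\<forall>x\<in>B - H i. \<forall>y\<in>B. \<exists>c. y - scale c x \<in> H i)) \<and>
    (\<forall>J\<subseteq>I. dim (B \<inter> (\<Inter>i\<in>J. H i)) + card J \<le> dim B + d)"
  using V dims
\<comment> \<open>The measure is the total codimension of the family; every enlargement of a
  \<open>V i\<close> lowers it.\<close>
proof (induction "\<Sum>i\<in>I. dim B - dim (V i)" arbitrary: V rule: less_induct)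
  case less
  show ?case
  proof (cases "\<forall>i\<in>I. \<forall>x\<in>B - V i. \<forall>y\<in>B. \<exists>c. y - scale c x \<in> V i")
    case True
    then show ?thesis using less.prems by (intro exI[of _ V]) blast
  next
    case False
    \<comment> \<open>The vectors \<open>x\<close> and \<open>y\<close> are linearly independent
      modulo \<open>V i\<close>. Adjoining one or the other to \<open>V i\<close> gives the two
      larger spaces to be tried.\<close>
    then obtain i x y where ixy: "i \<in> I" "x \<in> B" "x \<notin> V i" "y \<in> B"
      "\<And>c. y - scale c x \<notin> V i" by blast
    note Vi = less.prems(1)[OF ixy(1)] less.prems(2)[OF ixy(1)]
    have y: "y \<notin> V i" using ixy(5)[of 0] by simp
    \<comment> \<open>Enlarging \<open>V i\<close> affects the inequality only for index sets
      containing \<open>i\<close>. These are written as \<open>J\<close> together with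
      \<open>i\<close>, whence the term \<open>card J + 1\<close>.\<close>
    have step: ?thesis
      if z: "z \<in> B" "z \<notin> V i"
        and dz: "\<And>J. J \<subseteq> I - {i} \<Longrightarrow>
          dim (span (insert z (V i)) \<inter> (B \<inter> (\<Inter>i\<in>J. V i))) + (card J + 1) \<le> dim B + d" for z
    proof -
      let ?H = "span (insert z (V i))"
      let ?V = "V(i := ?H)"
      have ViH: "V i \<subset> ?H" using z(2) span_superset[of "insert z (V i)"] by blast
      have HB: "?H \<subseteq> B" using z Vi B by (intro span_minimal) auto
      have "(\<Sum>j\<in>I. dim B - dim (?V j)) < (\<Sum>j\<in>I. dim B - dim (V j))"
      proof (rule sum_strict_mono_ex1[OF I])
        have "dim (V i) < dim ?H"
          using fin_dim_psubset[OF fin_dim_subset[OF B(2) HB] _ Vi(1) ViH] by simp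
        moreover have "dim ?H \<le> dim B" using fin_dim_mono B HB by blast
        ultimately have "dim B - dim (?V i) < dim B - dim (V i)" by simp
        then show "\<exists>j\<in>I. dim B - dim (?V j) < dim B - dim (V j)" using ixy(1) by blast
        show "\<forall>j\<in>I. dim B - dim (?V j) \<le> dim B - dim (V j)"
          using \<open>dim (V i) < dim ?H\<close> diff_le_mono2[of "dim (V i)" "dim ?H" "dim B"] by simp
      qed
      moreover have "subspace (?V j)" "?V j \<subseteq> B" if "j \<in> I" for j
        using that less.prems HB by auto
      moreover have "dim (B \<inter> (\<Inter>j\<in>J. ?V j)) + card J \<le> dim B + d" if J: "J \<subseteq> I" for J
      proof (cases "i \<in> J")
        case True
        have "B \<inter> (\<Inter>j\<in>J. ?V j) = ?H \<inter> (B \<inter> (\<Inter>j\<in>J - {i}. V j))"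
          using True by (auto split: if_splits)
        moreover have "card J = card (J - {i}) + 1"
          using card_Suc_Diff1[OF finite_subset[OF J I] True] by linarith
        moreover have "J - {i} \<subseteq> I - {i}" using J by blast
        ultimately show ?thesis using dz by simp
      next
        case False
        then have "(\<Inter>j\<in>J. ?V j) = (\<Inter>j\<in>J. V j)" by auto
        then show ?thesis using less.prems(3)[OF J] by simp
      qed
      ultimately obtain H where H: "\<forall>j\<in>I. subspace (H j) \<and> ?V j \<subseteq> H j \<and> H j \<subseteq> B \<and>
          (\<forall>x\<in>B - H j. \<forall>y\<in>B. \<exists>c. y - scale c x \<in> H j)"
        "\<forall>J\<subseteq>I. dim (B \<inter> (\<Inter>j\<in>J. H j)) + card J \<le> dim B + d"
        using less.hyps[of ?V] by blast
      moreover have "V j \<subseteq> ?V j" for j using ViH by auto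
      ultimately show ?thesis by (intro exI[of _ H]) blast
    qed
    show ?thesis
    proof (rule ccontr)
      assume contr: "\<not> ?thesis"
      let ?X = "span (insert x (V i))" and ?Y = "span (insert y (V i))"
      have ex: "\<exists>J\<subseteq>I - {i}.
          dim (span (insert z (V i)) \<inter> (B \<inter> (\<Inter>i\<in>J. V i))) + (card J + 1) > dim B + d"
        if "z \<in> B" "z \<notin> V i" for z
      proof (rule ccontr)
        assume "\<not> ?thesis"
        then have "dim (span (insert z (V i)) \<inter> (B \<inter> (\<Inter>i\<in>J. V i))) + (card J + 1) \<le> dim B + d"
          if "J \<subseteq> I - {i}" for J using that not_le by blast
        then show False by (rule notE[OF contr step[OF that]])
      qed
      obtain J where J: "J \<subseteq> I - {i}"
          "dim (?X \<inter> (B \<inter> (\<Inter>i\<in>J. V i))) + (card J + 1) > dim B + d"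
        using ex[OF ixy(2,3)] by blast
      obtain J' where J': "J' \<subseteq> I - {i}"
          "dim (?Y \<inter> (B \<inter> (\<Inter>i\<in>J'. V i))) + (card J' + 1) > dim B + d"
        using ex[OF ixy(4) y] by blast
      let ?S = "?X \<inter> (B \<inter> (\<Inter>i\<in>J. V i))" and ?T = "?Y \<inter> (B \<inter> (\<Inter>i\<in>J'. V i))"
      have sub: "subspace (B \<inter> (\<Inter>i\<in>Q. V i))" if "Q \<subseteq> I" for Q
        using that less.prems(1) B(1) by (intro subspace_inter subspace_Int) auto
      have subST: "subspace ?S" "subspace ?T"
        using sub[of J] sub[of J'] J(1) J'(1) by (auto intro: subspace_inter)
      have fin: "fin_dim Q" if "Q \<subseteq> B" for Q using fin_dim_subset[OF B(2)] that .
      have XY: "v \<in> V i" if v: "v \<in> ?X" "v \<in> ?Y" for v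
      proof -
        from v obtain a b where a: "v - scale a x \<in> V i" and b: "v - scale b y \<in> V i"
          unfolding span_breakdown_eq span_eq_iff[THEN iffD2, OF Vi(1)] by blast
        show ?thesis
        proof (cases "b = 0")
          case True
          then show ?thesis using b by simp
        next
          case False
          have "scale (inverse b) ((v - scale a x) - (v - scale b y)) \<in> V i"
            by (intro subspace_scale subspace_diff Vi a b)
          then have "y - scale (inverse b * a) x \<in> V i"
            using False by (simp add: scale_right_diff_distrib)
          then show ?thesis using ixy(5) by blast
        qed
      qed
      have finJ: "finite J" "finite J'" using J J' I by (meson finite_subset finite_Diff)+
      \<comment> \<open>The intersection of \<open>?S\<close> and \<open>?T\<close> gains the index
        \<open>i\<close>, because the two enlargements meet only in \<open>V i\<close>. Adding the
        bounds for the union (with \<open>i\<close>) and the intersection of \<open>J\<close> and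
        \<open>J'\<close> gives
        \<open>dim ?S + dim ?T + card J + card J' + 1 \<le> 2 * (dim B + d)\<close>, while the two
        violated inequalities give
        \<open>dim ?S + dim ?T + card J + card J' \<ge> 2 * (dim B + d)\<close>.\<close>
      have "?S \<inter> ?T \<subseteq> B \<inter> (\<Inter>i\<in>insert i (J \<union> J'). V i)"
        using XY by auto
      then have "dim (?S \<inter> ?T) \<le> dim (B \<inter> (\<Inter>i\<in>insert i (J \<union> J'). V i))"
        using J(1) J'(1) ixy(1) by (intro fin_dim_mono fin sub) auto
      moreover have "dim (B \<inter> (\<Inter>i\<in>insert i (J \<union> J'). V i)) + card (insert i (J \<union> J')) \<le> dim B + d"
        using J(1) J'(1) ixy(1) by (intro less.prems) auto
      moreover have "card (insert i (J \<union> J')) = card (J \<union> J') + 1"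
        using J(1) J'(1) finJ by (subst card_insert_disjoint) auto
      moreover have "?S + ?T \<subseteq> B \<inter> (\<Inter>i\<in>J \<inter> J'. V i)"
      proof
        fix z assume "z \<in> ?S + ?T"
        then obtain s t where st: "z = s + t" "s \<in> ?S" "t \<in> ?T" by (rule set_plus_elim)
        then show "z \<in> B \<inter> (\<Inter>i\<in>J \<inter> J'. V i)"
          using J(1) subspace_add[OF B(1)] subspace_add[OF less.prems(1)] by auto
      qed
      then have "dim (?S + ?T) \<le> dim (B \<inter> (\<Inter>i\<in>J \<inter> J'. V i))"
        using J(1) by (intro fin_dim_mono fin sub) auto
      moreover have "dim (B \<inter> (\<Inter>i\<in>J \<inter> J'. V i)) + card (J \<inter> J') \<le> dim B + d"
        using J(1) by (intro less.prems) auto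
      moreover have "dim (?S + ?T) + dim (?S \<inter> ?T) = dim ?S + dim ?T"
        by (intro dim_set_plus_Int subST fin) auto
      moreover have "card (J \<union> J') + card (J \<inter> J') = card J + card J'"
        using card_Un_Int[OF finJ] by simp
      ultimately show False using J(2) J'(2) by linarith
    qed
  qed
qed

text \<open>The \<open>b i\<close> act as a dual family to linear functionals on \<open>B\<close>
  with kernels \<open>V i\<close>. Subtracting from \<open>y\<close> its components along the
  \<open>b i\<close> leaves a vector in all the kernels, since \<open>b i\<close> lies in
  \<open>V j\<close> for \<open>j \<noteq> i\<close>.\<close>

lemma biorthogonal_complement_span:
  assumes B: "subspace B" and P: "finite P"
    and V: "\<And>i. i \<in> P \<Longrightarrow> subspace (V i)"
    and hyp: "\<And>i x y. i \<in> P \<Longrightarrow> x \<in> B - V i \<Longrightarrow> y \<in> B \<Longrightarrow> \<exists>c. y - scale c x \<in> V i"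
    and b: "\<And>i. i \<in> P \<Longrightarrow> b i \<in> B - V i" "\<And>i j. i \<in> P \<Longrightarrow> j \<in> P \<Longrightarrow> i \<noteq> j \<Longrightarrow> b i \<in> V j"
  shows "span (b ` P \<union> (B \<inter> (\<Inter>i\<in>P. V i))) = B"
proof
  show "span (b ` P \<union> (B \<inter> (\<Inter>i\<in>P. V i))) \<subseteq> B"
    using b(1) B by (intro span_minimal) auto
  show "B \<subseteq> span (b ` P \<union> (B \<inter> (\<Inter>i\<in>P. V i)))"
  proof
    fix y assume y: "y \<in> B"
    have "\<forall>i\<in>P. \<exists>c. y - scale c (b i) \<in> V i"
      using hyp[OF _ b(1) y] by blast
    then obtain c where c: "\<And>i. i \<in> P \<Longrightarrow> y - scale (c i) (b i) \<in> V i" by metis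
    let ?s = "\<Sum>i\<in>P. scale (c i) (b i)"
    have "y - ?s \<in> V j" if j: "j \<in> P" for j
    proof -
      have "y - ?s = (y - scale (c j) (b j)) - (\<Sum>i\<in>P - {j}. scale (c i) (b i))"
        using sum.remove[OF P j, of "\<lambda>i. scale (c i) (b i)"] by simp
      also have "\<dots> \<in> V j"
        using b(2) j by (intro subspace_diff subspace_sum subspace_scale V c) auto
      finally show ?thesis .
    qed
    moreover have "y - ?s \<in> B"
      using b(1) by (intro subspace_diff[OF B] subspace_sum[OF B] subspace_scale[OF B] y) auto
    ultimately have "y - ?s \<in> span (b ` P \<union> (B \<inter> (\<Inter>i\<in>P. V i)))"
      by (intro span_base) auto
    moreover have "?s \<in> span (b ` P \<union> (B \<inter> (\<Inter>i\<in>P. V i)))"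
      by (intro span_sum span_scale span_base) auto
    ultimately show "y \<in> span (b ` P \<union> (B \<inter> (\<Inter>i\<in>P. V i)))"
      using span_add by fastforce
  qed
qed

text \<open>In terms of functionals: if the common kernel has codimension at least \<open>k\<close>,
  then \<open>k\<close> of them are independent and possess dual vectors. They are found one at a
  time.\<close>

lemma biorthogonal_subfamily:
  assumes B: "subspace B" "fin_dim B" and I: "finite I"
    and V: "\<And>i. i \<in> I \<Longrightarrow> subspace (V i)"
    and hyp: "\<And>i x y. i \<in> I \<Longrightarrow> x \<in> B - V i \<Longrightarrow> y \<in> B \<Longrightarrow> \<exists>c. y - scale c x \<in> V i"
    and dimI: "dim (B \<inter> (\<Inter>i\<in>I. V i)) + k \<le> dim B"
  shows "\<exists>P\<subseteq>I. \<exists>b. card P = k \<and> (\<forall>i\<in>P. b i \<in> B - V i) \<and>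
    (\<forall>i\<in>P. \<forall>j\<in>P. i \<noteq> j \<longrightarrow> b i \<in> V j)"
  using dimI
proof (induction k)
  case 0
  show ?case by (intro exI[of _ "{}"]) simp
next
  case (Suc k)
  then have "dim (B \<inter> (\<Inter>i\<in>I. V i)) + k \<le> dim B" by simp
  then obtain P b where P: "P \<subseteq> I" "card P = k" "\<And>i. i \<in> P \<Longrightarrow> b i \<in> B - V i"
    "\<And>i j. i \<in> P \<Longrightarrow> j \<in> P \<Longrightarrow> i \<noteq> j \<Longrightarrow> b i \<in> V j"
    using Suc.IH by blast
  have finP: "finite P" using finite_subset[OF P(1) I] .
  let ?W = "B \<inter> (\<Inter>i\<in>P. V i)"
  have W: "subspace ?W"
    using P(1) V B(1) by (intro subspace_inter subspace_Int) auto
  \<comment> \<open>Otherwise the \<open>k\<close> vectors \<open>b i\<close> together with the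
    common kernel of the whole family would span \<open>B\<close>, which contradicts the bound for
    \<open>Suc k\<close>.\<close>
  have "\<not> ?W \<subseteq> B \<inter> (\<Inter>i\<in>I. V i)"
  proof
    assume sub: "?W \<subseteq> B \<inter> (\<Inter>i\<in>I. V i)"
    obtain E where E: "finite E" "independent E" "span E = ?W" "card E = dim ?W"
      using fin_dim_basis[OF W] fin_dim_subset[OF B(2)] by auto
    have "span (b ` P \<union> ?W) = B"
      using P V hyp by (intro biorthogonal_complement_span B finP) auto
    then have "B \<subseteq> span (b ` P \<union> E)"
      using E(3) by (metis order_refl span_Un_set_plus span_span)
    then have "dim B \<le> card (b ` P \<union> E)"
      using dim_le_card finP E(1) by blast
    also have "\<dots> \<le> card P + card E"
      using card_Un_le[of "b ` P" E] card_image_le[OF finP, of b] by linarith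
    also have "card E \<le> dim (B \<inter> (\<Inter>i\<in>I. V i))"
      unfolding E(4) using V B by (intro fin_dim_mono sub subspace_inter subspace_Int
          fin_dim_subset[OF B(2)]) auto
    finally show False using Suc.prems P(2) by simp
  qed
  then obtain x j where x: "x \<in> B" "\<And>i. i \<in> P \<Longrightarrow> x \<in> V i" and j: "j \<in> I" "x \<notin> V j"
    by blast
  have jP: "j \<notin> P" using x j by blast
  have "\<forall>i\<in>P. \<exists>c. b i - scale c x \<in> V j"
    using hyp[OF j(1), of x] x j P(3) by blast
  then obtain c where c: "\<And>i. i \<in> P \<Longrightarrow> b i - scale (c i) x \<in> V j" by metis
  \<comment> \<open>The vector \<open>x\<close> is dual to the new index \<open>j\<close>. As
    \<open>x\<close> lies in \<open>V i\<close> for all \<open>i\<close> in \<open>P\<close>,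
    subtracting multiples of it puts the old vectors into \<open>V j\<close> without disturbing the
    old relations.\<close>
  define b' where "b' i = (if i = j then x else b i - scale (c i) x)" for i
  have b': "b' i = b i - scale (c i) x" if "i \<in> P" for i
    using that jP unfolding b'_def by auto
  have b'j: "b' j = x" unfolding b'_def by simp
  have 1: "b' i \<in> B - V i" if i: "i \<in> insert j P" for i
  proof (cases "i = j")
    case True
    then show ?thesis using b'j x j by simp
  next
    case False
    then have iP: "i \<in> P" using i by simp
    have "b' i \<in> B"
      unfolding b'[OF iP] using P(3)[OF iP] x(1) by (intro subspace_diff subspace_scale B) auto
    moreover have "b' i \<notin> V i"
    proof
      assume "b' i \<in> V i"
      moreover have "subspace (V i)" using iP P(1) V by blast
      ultimately have "b' i + scale (c i) x \<in> V i"
        using x(2)[OF iP] subspace_add subspace_scale by blast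
      then show False using P(3)[OF iP] unfolding b'[OF iP] by simp
    qed
    ultimately show ?thesis by blast
  qed
  have 2: "b' i \<in> V l" if il: "i \<in> insert j P" "l \<in> insert j P" "i \<noteq> l" for i l
  proof (cases "i = j")
    case True
    then show ?thesis using il b'j x(2) by simp
  next
    case False
    then have iP: "i \<in> P" using il by simp
    show ?thesis
    proof (cases "l = j")
      case True
      then show ?thesis using b'[OF iP] c[OF iP] by simp
    next
      case False
      then have l: "l \<in> P" using il by simp
      then have "subspace (V l)" using P(1) V by blast
      then show ?thesis
        unfolding b'[OF iP] using P(4)[OF iP l il(3)] x(2)[OF l]
        by (intro subspace_diff subspace_scale)
    qed
  qed
  have "card (insert j P) = Suc k" using jP finP P(2) by simp
  then show ?case using 1 2 P(1) j(1)
    by (intro exI[of _ "insert j P"] conjI exI[of _ b']) auto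
qed

text \<open>After enlargement to spaces \<open>H i\<close> of codimension at most one, the bound for
  all of \<open>{1..n}\<close> leaves a common intersection small enough for \<open>n - d\<close> of
  them to have dual vectors. These vectors, completed by a basis \<open>E\<close> of the
  intersection of the chosen \<open>H i\<close>, form the required basis.\<close>

lemma rado_basis:
  fixes V :: "nat \<Rightarrow> 'b set"
  assumes B: "subspace B" "fin_dim B" "dim B = n"
    and V: "\<And>i. i \<in> {1..n} \<Longrightarrow> subspace (V i)" "\<And>i. i \<in> {1..n} \<Longrightarrow> V i \<subseteq> B"
    and dims: "\<And>J. J \<subseteq> {1..n} \<Longrightarrow> dim (B \<inter> (\<Inter>i\<in>J. V i)) + card J \<le> n + d"
  shows "\<exists>b P. inj_on b {1..n} \<and> independent (b ` {1..n}) \<and> span (b ` {1..n}) = B \<and>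
    P \<subseteq> {1..n} \<and> card P = n - d \<and> (\<forall>i\<in>P. V i \<subseteq> span (b ` ({1..n} - {i})))"
proof -
  obtain H where H0: "\<forall>i\<in>{1..n}. subspace (H i) \<and> V i \<subseteq> H i \<and> H i \<subseteq> B \<and>
      (\<forall>x\<in>B - H i. \<forall>y\<in>B. \<exists>c. y - scale c x \<in> H i)"
    and dimH: "\<forall>J\<subseteq>{1..n}. dim (B \<inter> (\<Inter>i\<in>J. H i)) + card J \<le> n + d"
    using enlarge_to_hyperplanes[OF B(1,2) finite_atLeastAtMost V dims[folded B(3)]]
    unfolding B(3) by metis
  have H: "subspace (H i)" "V i \<subseteq> H i"
      "\<And>x y. x \<in> B - H i \<Longrightarrow> y \<in> B \<Longrightarrow> \<exists>c. y - scale c x \<in> H i" if "i \<in> {1..n}" for i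
    using bspec[OF H0 that] by blast+
  have "dim (B \<inter> (\<Inter>i\<in>{1..n}. H i)) + (n - d) \<le> dim B"
  proof (cases "d \<le> n")
    case True
    then show ?thesis using dimH[rule_format, of "{1..n}"] B(3) by simp
  next
    \<comment> \<open>Truncated subtraction makes \<open>n - d\<close> equal to 0 here.\<close>
    case False
    have "dim (B \<inter> (\<Inter>i\<in>{1..n}. H i)) \<le> dim B" by (intro fin_dim_mono B) auto
    with False show ?thesis by simp
  qed
  then obtain P b where P: "P \<subseteq> {1..n}" "card P = n - d"
    and b0: "\<forall>i\<in>P. b i \<in> B - H i" "\<forall>i\<in>P. \<forall>j\<in>P. i \<noteq> j \<longrightarrow> b i \<in> H j"
    using biorthogonal_subfamily[where I = "{1..n}" and V = H and k = "n - d",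
        OF B(1,2) finite_atLeastAtMost H(1) H(3)] by auto
  have b: "\<And>i. i \<in> P \<Longrightarrow> b i \<in> B - H i"
      "\<And>i j. i \<in> P \<Longrightarrow> j \<in> P \<Longrightarrow> i \<noteq> j \<Longrightarrow> b i \<in> H j"
    using b0 by blast+
  have finP: "finite P" using finite_subset[OF P(1)] by simp
  let ?W = "B \<inter> (\<Inter>i\<in>P. H i)"
  have "subspace ?W"
    using P(1) H(1) B(1) by (intro subspace_inter subspace_Int) auto
  then obtain E where E: "finite E" "independent E" "span E = ?W"
    using fin_dim_basis fin_dim_subset[OF B(2)] by (metis inf_le1)
  have EW: "E \<subseteq> ?W" using span_superset[of E] unfolding E(3) .
  have "span (b ` P \<union> ?W) = B"
    using P b H by (intro biorthogonal_complement_span B finP) auto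
  then have spanB: "span (b ` P \<union> E) = B"
    using E(3) by (metis span_Un_set_plus span_span)
  \<comment> \<open>Each added \<open>b i\<close> lies outside \<open>H i\<close>, whereas
    \<open>E\<close> and all other \<open>b j\<close> with \<open>j\<close> in \<open>P\<close> lie
    inside it.\<close>
  have ind: "independent (b ` Q \<union> E)" if "Q \<subseteq> P" for Q
    using finite_subset[OF that finP] that
  proof (induction Q rule: finite_induct)
    case empty
    then show ?case using E by simp
  next
    case (insert i Q)
    then have iP: "i \<in> P" by simp
    have "b ` Q \<union> E \<subseteq> H i"
      using insert EW iP b(2) by auto
    then have "span (b ` Q \<union> E) \<subseteq> H i"
      using P(1) iP H(1) by (intro span_minimal) auto
    then show ?case
      using b(1)[OF iP] insert independent_insertI[of "b i" "b ` Q \<union> E"] by auto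
  qed
  have injb: "inj_on b P" using b by (metis DiffE inj_onI)
  have disj: "b ` P \<inter> E = {}" using b(1) EW by blast
  have "card (b ` P \<union> E) = n"
    using dim_span_eq_card_independent[OF ind[OF order_refl]] spanB B(3) by simp
  then have "card E = card ({1..n} - P)"
    using disj injb finP E(1) P(1) by (simp add: card_Un_disjoint card_image card_Diff_subset)
  then obtain g where g: "bij_betw g ({1..n} - P) E"
    using E(1) finite_same_card_bij[of "{1..n} - P" E] by auto
  \<comment> \<open>Positions outside \<open>P\<close> carry no condition, so any bijection may
    distribute \<open>E\<close> over them.\<close>
  define b' where "b' i = (if i \<in> P then b i else g i)" for i
  have "bij_betw b' P (b ` P)"
    using injb inj_on_imp_bij_betw bij_betw_cong[of P b' b] unfolding b'_def by auto
  moreover have "bij_betw b' ({1..n} - P) E"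
    using g bij_betw_cong[of "{1..n} - P" b' g E] unfolding b'_def by auto
  ultimately have "bij_betw b' (P \<union> ({1..n} - P)) (b ` P \<union> E)"
    by (rule bij_betw_combine) (rule disj)
  then have bij: "bij_betw b' {1..n} (b ` P \<union> E)"
    using P(1) by (simp add: Un_absorb1)
  then have img: "b' ` {1..n} = b ` P \<union> E" unfolding bij_betw_def by blast
  have "V i \<subseteq> span (b' ` ({1..n} - {i}))" if i: "i \<in> P" for i
  proof
    fix v assume v: "v \<in> V i"
    have i': "i \<in> {1..n}" using i P(1) by blast
    have "b' ` {1..n} = insert (b i) (b' ` ({1..n} - {i}))"
      using i i' unfolding b'_def by auto
    moreover have "v \<in> span (b' ` {1..n})"
      using v i' V(2) unfolding img spanB by blast
    ultimately obtain k where k: "v - scale k (b i) \<in> span (b' ` ({1..n} - {i}))"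
      using span_breakdown_eq by metis
    have b'H: "b' j \<in> H i" if j: "j \<in> {1..n} - {i}" for j
    proof (cases "j \<in> P")
      case True
      then show ?thesis using b(2)[of j i] i j unfolding b'_def by simp
    next
      case False
      then have "g j \<in> E" using g j bij_betwE by blast
      then show ?thesis using False EW i unfolding b'_def by auto
    qed
    then have "span (b' ` ({1..n} - {i})) \<subseteq> H i"
      by (intro span_minimal image_subsetI b'H H(1)[OF i'])
    then have "v \<in> H i" "v - scale k (b i) \<in> H i"
      using k v H(2)[OF i'] by blast+
    from subspace_diff[OF H(1)[OF i'] this] have kH: "scale k (b i) \<in> H i" by simp
    \<comment> \<open>The vector \<open>v\<close> and all basis vectors other than
      \<open>b i\<close> lie in \<open>H i\<close>, but \<open>b i\<close> does not; so
      \<open>v\<close> has no component along \<open>b i\<close>.\<close>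
    have "k = 0"
    proof (rule ccontr)
      assume "k \<noteq> 0"
      then have "b i \<in> H i"
        using subspace_scale[OF H(1)[OF i'] kH, of "inverse k"] by simp
      then show False using b(1)[OF i] by blast
    qed
    then show "v \<in> span (b' ` ({1..n} - {i}))" using k by simp
  qed
  then show ?thesis
    using bij img spanB ind[OF order_refl] P
    by (intro exI[of _ b'] exI[of _ P]) (auto simp: bij_betw_def)
qed

end

section \<open>Multiplicative translates of subspaces of the extension field\<close>

lemma elt_set_times_eq_preimage:
  fixes e :: "'a::field"
  assumes "e \<noteq> 0"
  shows "e *o V = {x. inverse e * x \<in> V}"
proof -
  have "x \<in> e *o V" if "inverse e * x \<in> V" for x
    using set_times_intro2[OF that, of e] assms by (simp add: mult.assoc[symmetric])
  then show ?thesis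
    using assms by (auto simp: elt_set_times_def mult.assoc[symmetric])
qed

lemma mem_quotient_iff:
  fixes a :: "'a::field"
  assumes "a \<noteq> 0"
  shows "x \<in> inverse a *o V \<longleftrightarrow> a * x \<in> V"
  using assms by (simp add: elt_set_times_eq_preimage)

context field_extension
begin

interpretation vector_space "ext_scale emb"
  by (rule vector_space_ext_scale)

lemma subspace_mult_preimage:
  assumes "subspace V"
  shows "subspace {x. e * x \<in> V}"
proof (rule subspaceI)
  show "0 \<in> {x. e * x \<in> V}" using subspace_0[OF assms] by simp
next
  fix x y assume "x \<in> {x. e * x \<in> V}" "y \<in> {x. e * x \<in> V}"
  then show "x + y \<in> {x. e * x \<in> V}"
    using subspace_add[OF assms, of "e * x" "e * y"] by (simp add: distrib_left)
next
  fix c x assume "x \<in> {x. e * x \<in> V}"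
  then show "ext_scale emb c x \<in> {x. e * x \<in> V}"
    using subspace_scale[OF assms, of "e * x" c] by (simp add: ext_scale_def mult.left_commute)
qed

lemma subspace_transporter:
  assumes "subspace V"
  shows "subspace {x. \<forall>s\<in>S. s * x \<in> V}"
proof -
  have "{x. \<forall>s\<in>S. s * x \<in> V} = (\<Inter>s\<in>S. {x. s * x \<in> V})" by blast
  then show ?thesis
    using assms by (simp add: subspace_Int subspace_mult_preimage)
qed

lemma subspace_elt_set_times: "e \<noteq> 0 \<Longrightarrow> subspace V \<Longrightarrow> subspace (e *o V)"
  by (simp add: elt_set_times_eq_preimage subspace_mult_preimage)

lemma dim_elt_set_times:
  assumes "e \<noteq> 0" "subspace V" "fin_dim V"
  shows "fin_dim (e *o V)" "dim (e *o V) = dim V"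
proof -
  \<comment> \<open>Multiplication cannot raise the dimension. Applied both to \<open>e\<close> and
    to \<open>inverse e\<close>, this gives equality.\<close>
  have *: "fin_dim (c *o W) \<and> dim (c *o W) \<le> dim W" if W: "subspace W" "fin_dim W" for c W
  proof -
    obtain E where E: "finite E" "span E = W" "card E = dim W"
      using fin_dim_basis W by metis
    have "span E \<subseteq> {x. c * x \<in> span ((*) c ` E)}"
      by (intro span_minimal subspace_mult_preimage) (auto intro: span_base)
    then have "c *o W \<subseteq> span ((*) c ` E)"
      using E(2) unfolding elt_set_times_def by blast
    moreover have "finite ((*) c ` E)" "card ((*) c ` E) \<le> dim W"
      using E card_image_le[OF E(1), of "(*) c"] by auto
    ultimately show ?thesis
      unfolding fin_dim_def using dim_le_card le_trans by blast
  qed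
  then show fin: "fin_dim (e *o V)" using assms by blast
  have "inverse e *o (e *o V) = V"
    using assms(1) by (simp add: set_times_rearrange2)
  then have "dim V \<le> dim (e *o V)"
    using *[OF subspace_elt_set_times[OF assms(1,2)] fin, of "inverse e"] by simp
  then show "dim (e *o V) = dim V"
    using * assms by (simp add: le_antisym)
qed

section \<open>The Dyson transform and the bound for transporters\<close>

lemma dyson_transform:
  assumes A: "subspace A" "fin_dim A"
    and "subspace S" "S \<noteq> {0}" "subspace U" "fin_dim U" "1 \<in> U" "S * U \<subseteq> A"
  shows "\<exists>S' R. subspace S' \<and> S' \<noteq> {0} \<and> S' \<subseteq> A \<and> subspace R \<and> 1 \<in> R \<and> R \<subseteq> U \<and>
    S' * R = S' \<and> dim S' + dim R = dim S + dim U"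
  using assms(3-)
proof (induction "dim U" arbitrary: S U rule: less_induct)
  case less
  have SA: "S \<subseteq> A"
    using less.prems(5,6) set_times_intro[of _ S 1 U] by auto
  show ?case
  proof (cases "S * U \<subseteq> S")
    case True
    then have "S * U = S"
      using less.prems(5) set_times_intro[of _ S 1 U] by auto
    then show ?thesis using less.prems SA by blast
  next
    case False
    \<comment> \<open>This \<open>u\<close> belongs to \<open>U\<close> but not to the new
      \<open>?U\<close>, which makes the dimension drop.\<close>
    then obtain e u where e: "e \<in> S" "u \<in> U" "e * u \<notin> S"
      unfolding set_times_def by blast
    then have e0: "e \<noteq> 0" using subspace_0[OF less.prems(1)] by auto
    let ?S = "S + e *o U" and ?U = "U \<inter> {u. e * u \<in> S}"
    have U: "subspace ?U"
      by (intro subspace_inter less.prems subspace_mult_preimage)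
    have eU: "subspace (e *o U)" by (intro subspace_elt_set_times e0 less.prems)
    have S: "subspace ?S" by (intro subspace_set_plus less.prems eU)
    have dimU: "dim ?U < dim U"
      using e by (intro fin_dim_psubset less.prems U) auto
    have finU: "fin_dim ?U" using fin_dim_subset[OF less.prems(4)] by blast
    have SsubS: "S \<subseteq> ?S"
      using set_zero_plus2[OF subspace_0[OF eU], of S] by (simp add: add.commute)
    have "0 \<in> S" using subspace_0[OF less.prems(1)] .
    then have nz: "?S \<noteq> {0}" using SsubS less.prems(2) by blast
    have "?S * ?U \<subseteq> A"
    proof
      fix z assume "z \<in> ?S * ?U"
      then obtain s v w where z: "z = (s + e * v) * w" "s \<in> S" "v \<in> U" "w \<in> U" "e * w \<in> S"
        by (auto elim!: set_times_elim set_plus_elim simp: elt_set_times_def)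
      \<comment> \<open>Here \<open>e * w\<close> is in \<open>S\<close>, so both summands are
        products of an element of \<open>S\<close> and an element of \<open>U\<close>.\<close>
      then have "z = s * w + (e * w) * v" by (simp add: algebra_simps)
      moreover have "s * w \<in> A" "(e * w) * v \<in> A"
        using z less.prems(6) by blast+
      ultimately show "z \<in> A" using subspace_add[OF A(1)] by simp
    qed
    moreover have "1 \<in> ?U" using e less.prems(5) by simp
    ultimately obtain S' R where *: "subspace S'" "S' \<noteq> {0}" "S' \<subseteq> A" "subspace R" "1 \<in> R"
        "R \<subseteq> ?U" "S' * R = S'" "dim S' + dim R = dim ?S + dim ?U"
      using less.hyps[OF dimU S nz U finU] by blast
    \<comment> \<open>The dimension lost from \<open>U\<close> is exactly the one gained by
      \<open>S\<close>: the new \<open>?U\<close> is, up to the factor \<open>e\<close>, the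
      intersection in the modular law for \<open>S\<close> and \<open>e *o U\<close>.\<close>
    have "S \<inter> e *o U = e *o ?U" unfolding elt_set_times_def by blast
    then have "dim (S \<inter> e *o U) = dim ?U"
      using dim_elt_set_times[OF e0 U finU] by simp
    then have "dim ?S + dim ?U = dim S + dim U"
      using dim_set_plus_Int[OF less.prems(1) eU fin_dim_subset[OF A(2) SA]]
        dim_elt_set_times[OF e0 less.prems(3,4)] by simp
    with * show ?thesis by (intro exI[of _ S'] exI[of _ R]) auto
  qed
qed

lemma mem_span_insert_1:
  assumes "subspace W" "x \<in> span (insert 1 W)"
  obtains k where "x - emb k \<in> W"
  using assms span_breakdown_eq[of x 1 W] by (auto simp: ext_scale_def span_eq_iff[THEN iffD2])

text \<open>The Dyson transform is applied to \<open>S\<close> and \<open>?U + K\<close>. Adjoining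
  1 raises the dimension of \<open>?U\<close> by exactly one since \<open>1 \<notin> B\<close>, and
  passing from \<open>R\<close> back to \<open>B \<inter> R\<close> loses at most one, so the bound
  for the stable pair carries over to \<open>S\<close> and \<open>?U\<close>.\<close>

lemma dim_transporter_le:
  assumes A: "subspace A" "fin_dim A" and B: "subspace B" "fin_dim B" and "1 \<notin> B"
    and S: "subspace S" "S \<noteq> {0}" "S \<subseteq> A"
    and hyp: "\<And>S R. subspace S \<Longrightarrow> S \<noteq> {0} \<Longrightarrow> S \<subseteq> A \<Longrightarrow> subspace R \<Longrightarrow> R \<noteq> {0} \<Longrightarrow>
      R \<subseteq> B + range emb \<Longrightarrow> S * R = S \<Longrightarrow> dim S + dim (B \<inter> R) \<le> m"
  shows "dim S + dim (B \<inter> {x. \<forall>s\<in>S. s * x \<in> A}) \<le> m"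
proof -
  let ?U = "B \<inter> {x. \<forall>s\<in>S. s * x \<in> A}"
  have U: "subspace ?U"
    by (intro subspace_inter B subspace_transporter A)
  have finU: "fin_dim ?U" using fin_dim_subset[OF B(2)] by blast
  have dimU: "dim (span (insert 1 ?U)) = dim ?U + 1"
    using dim_span_insert[OF U finU] assms(5) by blast
  then have fin1U: "fin_dim (span (insert 1 ?U))"
    by (intro fin_dim_if_dim_pos) simp
  have "S * span (insert 1 ?U) \<subseteq> A"
  proof
    fix z assume "z \<in> S * span (insert 1 ?U)"
    then obtain s x where z: "z = s * x" "s \<in> S" "x \<in> span (insert 1 ?U)"
      by (rule set_times_elim)
    have "span (insert 1 ?U) \<subseteq> {x. s * x \<in> A}"
      using z(2) S(3) by (intro span_minimal subspace_mult_preimage A) auto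
    then show "z \<in> A" using z by blast
  qed
  then obtain S' R where R: "subspace S'" "S' \<noteq> {0}" "S' \<subseteq> A" "subspace R" "1 \<in> R"
      "R \<subseteq> span (insert 1 ?U)" "S' * R = S'"
      and dims: "dim S' + dim R = dim S + dim (span (insert 1 ?U))"
    using dyson_transform[OF A S(1,2) subspace_span fin1U] span_base[of 1 "insert 1 ?U"] by auto
  have RB: "R \<subseteq> B + range emb"
  proof
    fix x assume "x \<in> R"
    then obtain k where "x - emb k \<in> ?U"
      using R(6) mem_span_insert_1[OF U] by blast
    then show "x \<in> B + range emb"
      using set_plus_intro[of "x - emb k" B "emb k" "range emb"] by simp
  qed
  have BR: "subspace (B \<inter> R)" by (intro subspace_inter B R)
  \<comment> \<open>Since 1 is in \<open>R\<close>, so are all scalars; removing the scalar part of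
    an element of \<open>R\<close> therefore stays in \<open>R\<close> and lands in
    \<open>B\<close>.\<close>
  have "R \<subseteq> span (insert 1 (B \<inter> R))"
  proof
    fix x assume x: "x \<in> R"
    then obtain k where k: "x - emb k \<in> ?U"
      using R(6) mem_span_insert_1[OF U] by blast
    have "emb k \<in> R"
      using subspace_scale[OF R(4,5), of k] by (simp add: ext_scale_def)
    then have "x - emb k \<in> B \<inter> R"
      using k x subspace_diff[OF R(4)] by blast
    then have "x - ext_scale emb k 1 \<in> span (B \<inter> R)"
      by (simp add: ext_scale_def span_base)
    then show "x \<in> span (insert 1 (B \<inter> R))"
      unfolding span_breakdown_eq by blast
  qed
  moreover have dimBR: "dim (span (insert 1 (B \<inter> R))) = dim (B \<inter> R) + 1"
    using dim_span_insert[OF BR fin_dim_subset[OF B(2)]] assms(5) by blast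
  ultimately have "dim R \<le> dim (B \<inter> R) + 1"
    using fin_dim_mono[OF fin_dim_if_dim_pos subspace_span] by (metis less_add_one not_gr_zero not_less0)
  moreover have "dim S' + dim (B \<inter> R) \<le> m"
    using R(1-5,7) RB by (intro hyp) auto
  ultimately show ?thesis using dims dimU by linarith
qed

section \<open>Partial matchings and dimension inequalities\<close>

lemma ordered_basis_nonzero:
  assumes "ordered_basis emb n a A" "i \<in> {1..n}"
  shows "a i \<noteq> 0"
  using assms dependent_zero unfolding ordered_basis_def by (metis imageI)

text \<open>Match a basis of \<open>A\<close> that extends a basis of \<open>S\<close>. If
  \<open>a i\<close> is in \<open>S\<close> and \<open>x\<close> is in \<open>B \<inter> R\<close>,
  then \<open>a i * x\<close> is in \<open>S\<close>, hence in \<open>A\<close>; so for matched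
  \<open>i\<close> the vector \<open>x\<close> has no component along \<open>b i\<close>. This
  removes at least \<open>dim S - d\<close> coordinates.\<close>

lemma partially_matched_imp_dim_le:
  assumes A: "subspace A" "fin_dim A" "dim A = n" and B: "subspace B"
    and match: "partially_matched emb n A B d" and d: "d \<le> n"
    and S: "subspace S" "S \<subseteq> A" and SR: "S * R = S"
  shows "dim S + dim (B \<inter> R) \<le> n + d"
proof -
  obtain E where E: "finite E" "independent E" "span E = S" "card E = dim S"
    using fin_dim_basis[OF S(1) fin_dim_subset[OF A(2) S(2)]] by blast
  have "E \<subseteq> A" using E(3) S(2) span_superset[of E] by blast
  then obtain D where D: "E \<subseteq> D" "finite D" "independent D" "span D = A" "card D = n"
    using fin_dim_extend_basis[OF A(1,2) E(2)] A(3) by metis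
  obtain a where a: "bij_betw a {1..n} D"
    using finite_same_card_bij[of "{1..n}" D] D by auto
  then have a': "inj_on a {1..n}" "a ` {1..n} = D" by (auto simp: bij_betw_def)
  then have ob: "ordered_basis emb n a A" using D unfolding ordered_basis_def by simp
  then obtain b P where b: "inj_on b {1..n}" "independent (b ` {1..n})" "span (b ` {1..n}) = B"
    and P: "P \<subseteq> {1..n}" "card P = n - d"
      "\<And>i. i \<in> P \<Longrightarrow> (inverse (a i) *o A) \<inter> B \<subseteq> span (b ` ({1..n} - {i}))"
    using match unfolding partially_matched_def bases_partially_matched_def ordered_basis_def
    by metis
  define J where "J = {i \<in> {1..n}. a i \<in> E}"
  have "a ` J = E" using a'(2) D(1) unfolding J_def by auto
  moreover have "inj_on a J" using a'(1) by (rule inj_on_subset) (auto simp: J_def)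
  ultimately have cardJ: "card J = dim S" using E(4) card_image by metis
  have J: "J \<subseteq> {1..n}" unfolding J_def by blast
  let ?Q = "J \<inter> P"
  have "B \<inter> R \<subseteq> span (b ` ({1..n} - ?Q))"
  proof
    fix x assume x: "x \<in> B \<inter> R"
    \<comment> \<open>The full basis is included to keep the family nonempty when \<open>?Q\<close>
      is empty.\<close>
    let ?F = "insert (b ` {1..n}) ((\<lambda>i. b ` ({1..n} - {i})) ` ?Q)"
    have "x \<in> span (b ` ({1..n} - {i}))" if i: "i \<in> ?Q" for i
    proof -
      have "a i \<in> S" using i E(3) span_base unfolding J_def by blast
      then have "a i * x \<in> A" using x SR S(2) by blast
      then have "x \<in> (inverse (a i) *o A) \<inter> B"
        using x mem_quotient_iff ordered_basis_nonzero[OF ob, of i] i J by blast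
      then show ?thesis using P(3) i by blast
    qed
    then have "x \<in> span (\<Inter>?F)"
      using x b by (intro span_Inter_independent[OF b(2)]) auto
    moreover have "\<Inter>?F \<subseteq> b ` ({1..n} - ?Q)"
    proof
      fix y assume y: "y \<in> \<Inter>?F"
      then obtain i where i: "i \<in> {1..n}" "y = b i" by auto
      have "i \<notin> ?Q"
      proof
        assume "i \<in> ?Q"
        then have "b i \<in> b ` ({1..n} - {i})" using y i by blast
        then show False using inj_on_image_mem_iff[OF b(1) i(1)] by blast
      qed
      then show "y \<in> b ` ({1..n} - ?Q)" using i by blast
    qed
    ultimately show "x \<in> span (b ` ({1..n} - ?Q))" using span_mono by blast
  qed
  then have "dim (B \<inter> R) \<le> card (b ` ({1..n} - ?Q))"
    by (rule dim_le_card) simp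
  also have "\<dots> \<le> card ({1..n} - ?Q)" by (rule card_image_le) simp
  also have "\<dots> = n - card ?Q" using J by (subst card_Diff_subset) (auto intro: finite_subset)
  finally have "dim (B \<inter> R) \<le> n - card ?Q" .
  moreover have "card ?Q \<le> n" using card_mono[of "{1..n}" ?Q] J by auto
  moreover have "card (J \<union> P) \<le> n" using card_mono[of "{1..n}" "J \<union> P"] J P(1) by auto
  \<comment> \<open>As \<open>P\<close> omits \<open>d\<close> indices, \<open>?Q\<close> has at
    least \<open>dim S - d\<close> elements.\<close>
  moreover have "card J + card P = card (J \<union> P) + card ?Q"
    using J P(1) finite_subset by (intro card_Un_Int) auto
  ultimately show ?thesis using P(2) d cardJ by linarith
qed

text \<open>For nonempty \<open>J\<close>, the span of the \<open>a i\<close> with \<open>i\<close>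
  in \<open>J\<close> has dimension \<open>card J\<close>, and an element of \<open>B\<close> lying
  in every \<open>?V i\<close> with \<open>i\<close> in \<open>J\<close> multiplies this whole span
  into \<open>A\<close>. The assumed bounds thus supply the condition of
  \<open>rado_basis\<close>.\<close>

lemma partially_matchedI:
  assumes A: "subspace A" and B: "subspace B" "fin_dim B" "dim B = n"
    and dims: "\<And>S. subspace S \<Longrightarrow> S \<noteq> {0} \<Longrightarrow> S \<subseteq> A \<Longrightarrow>
      dim S + dim (B \<inter> {x. \<forall>s\<in>S. s * x \<in> A}) \<le> n + d"
  shows "partially_matched emb n A B d"
  unfolding partially_matched_def
proof (intro allI impI)
  fix a assume ob: "ordered_basis emb n a A"
  then have a: "inj_on a {1..n}" "independent (a ` {1..n})" "span (a ` {1..n}) = A"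
    unfolding ordered_basis_def by blast+
  let ?V = "\<lambda>i. (inverse (a i) *o A) \<inter> B"
  have "dim (B \<inter> (\<Inter>i\<in>J. ?V i)) + card J \<le> n + d" if J: "J \<subseteq> {1..n}" for J
  proof (cases "J = {}")
    \<comment> \<open>The span of no vectors is zero, a case outside \<open>dims\<close>; the
      intersection is then \<open>B\<close> itself.\<close>
    case True
    then show ?thesis using B(3) by simp
  next
    case False
    then obtain j where j: "j \<in> J" by blast
    let ?S = "span (a ` J)"
    have "a ` J \<subseteq> a ` {1..n}" using J by blast
    then have ind: "independent (a ` J)" and SA: "?S \<subseteq> A"
      using independent_mono[OF a(2)] span_mono a(3) by blast+
    have "dim ?S = card (a ` J)" using dim_span_eq_card_independent[OF ind] .
    then have dimS: "dim ?S = card J" using card_image[OF inj_on_subset[OF a(1) J]] by simp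
    have nz: "a i \<noteq> 0" if "i \<in> J" for i using ordered_basis_nonzero[OF ob] that J by blast
    have "?S \<noteq> {0}" using nz[OF j] j span_base[of "a j" "a ` J"] by auto
    then have "dim ?S + dim (B \<inter> {x. \<forall>s\<in>?S. s * x \<in> A}) \<le> n + d"
      using dims[OF subspace_span _ SA] by blast
    moreover have "B \<inter> (\<Inter>i\<in>J. ?V i) \<subseteq> B \<inter> {x. \<forall>s\<in>?S. s * x \<in> A}"
    proof
      fix x assume x: "x \<in> B \<inter> (\<Inter>i\<in>J. ?V i)"
      have "?S \<subseteq> {s. x * s \<in> A}"
      proof (intro span_minimal subspace_mult_preimage A subsetI)
        fix s assume "s \<in> a ` J"
        then obtain i where i: "i \<in> J" "s = a i" by blast
        then have "x \<in> inverse (a i) *o A" using x by blast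
        then show "s \<in> {s. x * s \<in> A}"
          using mem_quotient_iff[OF nz[OF i(1)]] i(2) by (simp add: mult.commute)
      qed
      then show "x \<in> B \<inter> {x. \<forall>s\<in>?S. s * x \<in> A}" using x by (auto simp: mult.commute)
    qed
    then have "dim (B \<inter> (\<Inter>i\<in>J. ?V i)) \<le> dim (B \<inter> {x. \<forall>s\<in>?S. s * x \<in> A})"
      by (intro fin_dim_mono fin_dim_subset[OF B(2)] subspace_inter B subspace_transporter A) blast
    ultimately show ?thesis using dimS by linarith
  qed
  moreover have "subspace (?V i)" if "i \<in> {1..n}" for i
    using ordered_basis_nonzero[OF ob that]
    by (intro subspace_inter subspace_elt_set_times A B) simp
  ultimately obtain b P where "inj_on b {1..n}" "independent (b ` {1..n})" "span (b ` {1..n}) = B"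
    "P \<subseteq> {1..n}" "card P = n - d" "\<forall>i\<in>P. ?V i \<subseteq> span (b ` ({1..n} - {i}))"
    using rado_basis[OF B, of ?V d] by blast
  then show "\<exists>b. ordered_basis emb n b B \<and> bases_partially_matched emb n A B d a b"
    unfolding ordered_basis_def bases_partially_matched_def by blast
qed

end

theorem theorem3p3:
  fixes emb :: "'k::field \<Rightarrow> 'l::field"
    and A B :: "'l set"
    and n d :: nat
  assumes "field_extension emb"
    and "range emb \<subset> UNIV"
    and "ext_subspace emb A" and "ext_subspace emb B"
    and "n > 0" and "ext_dim emb A = n" and "ext_dim emb B = n"
    and "1 \<notin> B"
    and "d \<le> n"
  shows "partially_matched emb n A B d \<longleftrightarrow>
    (\<forall>S R. ext_subspace emb S \<and> S \<noteq> {0} \<and> S \<subseteq> A \<and>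
           ext_subspace emb R \<and> R \<noteq> {0} \<and> R \<subseteq> B + range emb \<and> S * R = S \<longrightarrow>
      int (ext_dim emb S) - int d \<le> int (ext_quot_dim emb B (B \<inter> R)))"
proof -
  interpret field_extension emb by fact
  interpret vector_space "ext_scale emb" by (rule vector_space_ext_scale)
  have fin: "fin_dim A" "fin_dim B"
    using assms by (simp_all add: fin_dim_if_dim_pos)
  \<comment> \<open>With the quotient dimension written as \<open>n - dim (B \<inter> R)\<close>,
    the criterion becomes a bound on a sum of natural numbers, the form used in both
    directions.\<close>
  have quot: "int (dim S) - int d \<le> int (quot_dim B (B \<inter> R)) \<longleftrightarrow> dim S + dim (B \<inter> R) \<le> n + d"
    if "subspace R" for S R
    using quot_dim_plus_dim[of B "B \<inter> R"] subspace_inter that assms fin by fastforce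
  show ?thesis
  proof
    assume "partially_matched emb n A B d"
    then show "\<forall>S R. subspace S \<and> S \<noteq> {0} \<and> S \<subseteq> A \<and>
           subspace R \<and> R \<noteq> {0} \<and> R \<subseteq> B + range emb \<and> S * R = S \<longrightarrow>
      int (dim S) - int d \<le> int (quot_dim B (B \<inter> R))"
      using partially_matched_imp_dim_le[OF assms(3) fin(1) assms(6,4)] quot assms(9) by blast
  next
    assume *: "\<forall>S R. subspace S \<and> S \<noteq> {0} \<and> S \<subseteq> A \<and>
           subspace R \<and> R \<noteq> {0} \<and> R \<subseteq> B + range emb \<and> S * R = S \<longrightarrow>
      int (dim S) - int d \<le> int (quot_dim B (B \<inter> R))"
    have "dim S + dim (B \<inter> {x. \<forall>s\<in>S. s * x \<in> A}) \<le> n + d"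
      if "subspace S" "S \<noteq> {0}" "S \<subseteq> A" for S
      using * quot by (intro dim_transporter_le assms fin that) blast
    then show "partially_matched emb n A B d"
      by (intro partially_matchedI assms fin)
  qed
qed

end
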